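(* Let $A$ be a right-cancellable protomodular algebra (with protomodular operations $\theta,\alpha_1,\dots,\alpha_n,e_1,\dots,e_n$). Then the Mal'cev operation $$p(a,b,c)=\theta(\alpha_{1}(a,b),\alpha_{2}(a,b),\dots,\alpha_{n}(a,b),c)$$ on $A$ is associative, i.e. $$p(x,t,p(s,y,z))=p(p(x,t,s),y,z)$$ for all $x,t,s,y,z\in A$.
   Context: Fix a natural number $n\geq 1$. A protomodular algebra is an algebra $A$ from a variety of universal algebras whose algebraic theory contains protomodular terms, i.e. 0-ary terms $e_1,\dots,e_n$, binary terms $\alpha_1,\dots,\alpha_n$ and an $(n+1)$-ary term $\theta$ satisfying the identities $$\alpha_i(a,a)=e_i\quad (1\le i\le n),\qquad \theta(\alpha_1(a,b),\dots,\alpha_n(a,b),b)=a.$$ The same symbols denote the corresponding operations on $A$. $A$ is right-cancellable (with respect to these terms) if for every $i$ ($1\le i\le n$) and all $a_1,\dots,a_n,a_1',\dots,a_n',b,b'\in A$ $$\alpha_i(\theta(a_1,\dots,a_n,b),\theta(a_1',\dots,a_n',b))=\alpha_i(\theta(a_1,\dots,a_n,b'),\theta(a_1',\dots,a_n',b')).$$ *)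

theory Defs
  imports Main
begin

text \<open>
  Universal algebra: a signature is an arity function \<open>ar\<close> on the type of operation symbols, a
  variety is the class of all algebras of that signature satisfying a set \<open>E\<close> of identities, and
  its algebraic theory consists of the terms modulo the identities derivable from \<open>E\<close>.
\<close>

datatype (syms: 'f, vars: 'v) trm = Var 'v | App 'f "('f, 'v) trm list"

primrec wf_trm :: "('f \<Rightarrow> nat) \<Rightarrow> ('f, 'v) trm \<Rightarrow> bool" where
  "wf_trm ar (Var x) = True"
| "wf_trm ar (App f ts) = (length ts = ar f \<and> list_all (wf_trm ar) ts)"

primrec subst :: "('v \<Rightarrow> ('f, 'w) trm) \<Rightarrow> ('f, 'v) trm \<Rightarrow> ('f, 'w) trm" where
  "subst \<sigma> (Var x) = \<sigma> x"
| "subst \<sigma> (App f ts) = App f (map (subst \<sigma>) ts)"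

primrec interp :: "('f \<Rightarrow> 'a list \<Rightarrow> 'a) \<Rightarrow> ('v \<Rightarrow> 'a) \<Rightarrow> ('f, 'v) trm \<Rightarrow> 'a" where
  "interp I v (Var x) = v x"
| "interp I v (App f ts) = I f (map (interp I v) ts)"

inductive derivable ::
  "('f \<Rightarrow> nat) \<Rightarrow> (('f, nat) trm \<times> ('f, nat) trm) set \<Rightarrow> ('f, nat) trm \<Rightarrow> ('f, nat) trm \<Rightarrow> bool"
  for ar E where
  ax: "(s, t) \<in> E \<Longrightarrow> (\<forall>x. wf_trm ar (\<sigma> x)) \<Longrightarrow> derivable ar E (subst \<sigma> s) (subst \<sigma> t)"
| refl: "wf_trm ar t \<Longrightarrow> derivable ar E t t"
| sym: "derivable ar E s t \<Longrightarrow> derivable ar E t s"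
| trans: "derivable ar E s t \<Longrightarrow> derivable ar E t u \<Longrightarrow> derivable ar E s u"
| cong: "length ss = ar f \<Longrightarrow> list_all2 (derivable ar E) ss ts \<Longrightarrow>
    derivable ar E (App f ss) (App f ts)"

definition algebra :: "('f \<Rightarrow> nat) \<Rightarrow> 'a set \<Rightarrow> ('f \<Rightarrow> 'a list \<Rightarrow> 'a) \<Rightarrow> bool" where
  "algebra ar A I \<longleftrightarrow> (\<forall>f as. length as = ar f \<and> set as \<subseteq> A \<longrightarrow> I f as \<in> A)"

definition in_variety ::
  "('f \<Rightarrow> nat) \<Rightarrow> (('f, nat) trm \<times> ('f, nat) trm) set \<Rightarrow> 'a set \<Rightarrow> ('f \<Rightarrow> 'a list \<Rightarrow> 'a) \<Rightarrow> bool"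
  where
  "in_variety ar E A I \<longleftrightarrow> algebra ar A I \<and>
     (\<forall>(s, t)\<in>E. \<forall>v. range v \<subseteq> A \<longrightarrow> interp I v s = interp I v t)"

text \<open>
  A \<open>k\<close>-ary term has its variables among \<open>0, \<dots>, k - 1\<close>. In \<open>inst t us\<close> and \<open>term_op I t as\<close> the
  list must have length \<open>k\<close>; its \<open>j\<close>-th entry is put in place of the variable \<open>j\<close>.
\<close>

definition kary :: "('f \<Rightarrow> nat) \<Rightarrow> nat \<Rightarrow> ('f, nat) trm \<Rightarrow> bool" where
  "kary ar k t \<longleftrightarrow> wf_trm ar t \<and> vars t \<subseteq> {..<k}"

definition inst :: "('f, nat) trm \<Rightarrow> ('f, nat) trm list \<Rightarrow> ('f, nat) trm" where
  "inst t us = subst (\<lambda>j. us ! j) t"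

definition term_op :: "('f \<Rightarrow> 'a list \<Rightarrow> 'a) \<Rightarrow> ('f, nat) trm \<Rightarrow> 'a list \<Rightarrow> 'a" where
  "term_op I t as = interp I (\<lambda>j. as ! j) t"

text \<open>
  The families \<open>e\<close> and \<open>\<alpha>\<close> are indexed by \<open>1, \<dots>, n\<close>. In the two identities the variables \<open>a\<close>
  and \<open>b\<close> are \<open>Var 0\<close> and \<open>Var 1\<close>.
\<close>

definition protomodular_terms ::
  "('f \<Rightarrow> nat) \<Rightarrow> (('f, nat) trm \<times> ('f, nat) trm) set \<Rightarrow> nat \<Rightarrow>
   (nat \<Rightarrow> ('f, nat) trm) \<Rightarrow> (nat \<Rightarrow> ('f, nat) trm) \<Rightarrow> ('f, nat) trm \<Rightarrow> bool" where
  "protomodular_terms ar E n e \<alpha> \<theta> \<longleftrightarrow>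
     (\<forall>i\<in>{1..n}. kary ar 0 (e i) \<and> kary ar 2 (\<alpha> i)) \<and> kary ar (n + 1) \<theta> \<and>
     (\<forall>i\<in>{1..n}. derivable ar E (inst (\<alpha> i) [Var 0, Var 0]) (e i)) \<and>
     derivable ar E
       (inst \<theta> (map (\<lambda>i. inst (\<alpha> i) [Var 0, Var 1]) [1..<n + 1] @ [Var 1])) (Var 0)"

definition protomodular_algebra ::
  "('f \<Rightarrow> nat) \<Rightarrow> (('f, nat) trm \<times> ('f, nat) trm) set \<Rightarrow> nat \<Rightarrow>
   (nat \<Rightarrow> ('f, nat) trm) \<Rightarrow> (nat \<Rightarrow> ('f, nat) trm) \<Rightarrow> ('f, nat) trm \<Rightarrow>
   'a set \<Rightarrow> ('f \<Rightarrow> 'a list \<Rightarrow> 'a) \<Rightarrow> bool" where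
  "protomodular_algebra ar E n e \<alpha> \<theta> A I \<longleftrightarrow>
     (\<forall>(s, t)\<in>E. wf_trm ar s \<and> wf_trm ar t) \<and>
     protomodular_terms ar E n e \<alpha> \<theta> \<and> in_variety ar E A I"

definition right_cancellable ::
  "nat \<Rightarrow> (nat \<Rightarrow> ('f, nat) trm) \<Rightarrow> ('f, nat) trm \<Rightarrow> 'a set \<Rightarrow> ('f \<Rightarrow> 'a list \<Rightarrow> 'a) \<Rightarrow> bool" where
  "right_cancellable n \<alpha> \<theta> A I \<longleftrightarrow>
     (\<forall>i\<in>{1..n}. \<forall>as as' b b'.
        length as = n \<and> set as \<subseteq> A \<and> length as' = n \<and> set as' \<subseteq> A \<and> b \<in> A \<and> b' \<in> A \<longrightarrow>
        term_op I (\<alpha> i) [term_op I \<theta> (as @ [b]), term_op I \<theta> (as' @ [b])] =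
        term_op I (\<alpha> i) [term_op I \<theta> (as @ [b']), term_op I \<theta> (as' @ [b'])])"

definition malcev ::
  "nat \<Rightarrow> (nat \<Rightarrow> ('f, nat) trm) \<Rightarrow> ('f, nat) trm \<Rightarrow> ('f \<Rightarrow> 'a list \<Rightarrow> 'a) \<Rightarrow> 'a \<Rightarrow> 'a \<Rightarrow> 'a \<Rightarrow> 'a"
  where
  "malcev n \<alpha> \<theta> I a b c = term_op I \<theta> (map (\<lambda>i. term_op I (\<alpha> i) [a, b]) [1..<n + 1] @ [c])"

end

theory Submission
  imports Defs
begin

text \<open>
  Read \<open>\<alpha>(a, b) = (\<alpha>\<^sub>1(a, b), \<dots>, \<alpha>\<^sub>n(a, b))\<close> as the difference of \<open>a\<close> and \<open>b\<close>, and
  \<open>\<theta>(d, c)\<close> as the result of adding a difference \<open>d\<close> to \<open>c\<close>; then \<open>p(a, b, c)\<close> adds the difference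
  of \<open>a\<close> and \<open>b\<close> to \<open>c\<close>. An element is determined by its difference to a fixed base point, since
  \<open>\<theta>(\<alpha>(a, b), b) = a\<close>.

  Right-cancellability makes differences invariant under the translations \<open>p(-, b, c)\<close>: as
  \<open>x = \<theta>(\<alpha>(x, b), b)\<close> and \<open>y = \<theta>(\<alpha>(y, b), b)\<close>, replacing the common last argument \<open>b\<close> by \<open>c\<close> gives
  \<open>\<alpha>(p(x, b, c), p(y, b, c)) = \<alpha>(x, y)\<close> (lemma \<open>alpha_translation_invariant\<close>). Since
  \<open>p(t, t, s) = s\<close>, it follows that \<open>u = p(x, t, s)\<close> has the same difference to \<open>s\<close> as \<open>x\<close> has
  to \<open>t\<close>. Translating by \<open>p(-, y, z)\<close> once more, \<open>p(u, y, z)\<close> has this difference to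
  \<open>p(s, y, z)\<close> too, so it equals \<open>\<theta>(\<alpha>(x, t), p(s, y, z)) = p(x, t, p(s, y, z))\<close>.

  The identities of protomodular terms hold in the theory of the variety, that is, they are
  derivable. They are transferred to the algebra by soundness of equational logic
  (lemma \<open>derivable_sound\<close>).
\<close>

lemma interp_subst: "interp I v (subst \<sigma> t) = interp I (\<lambda>x. interp I v (\<sigma> x)) t"
  by (induction t) (simp_all add: comp_def cong: map_cong)

lemma interp_cong_vars: "(\<And>x. x \<in> vars t \<Longrightarrow> v x = w x) \<Longrightarrow> interp I v t = interp I w t"
proof (induction t)
  case (App f ts)
  have "map (interp I v) ts = map (interp I w) ts"
    using App by (intro map_cong) auto
  then show ?case by (simp only: interp.simps)
qed simp

lemma interp_closed:
  assumes "algebra ar A I"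
  shows "wf_trm ar t \<Longrightarrow> (\<And>x. x \<in> vars t \<Longrightarrow> v x \<in> A) \<Longrightarrow> interp I v t \<in> A"
proof (induction t)
  case (App f ts)
  then have "set (map (interp I v) ts) \<subseteq> A"
    by (auto simp: list_all_iff)
  with App.prems(1) assms show ?case
    by (simp add: algebra_def)
qed simp

lemma derivable_sound:
  assumes "in_variety ar E A I"
  shows "derivable ar E s t \<Longrightarrow> range v \<subseteq> A \<Longrightarrow> interp I v s = interp I v t"
proof (induction rule: derivable.induct)
  case (ax s t \<sigma>)
  have "algebra ar A I"
    using assms by (simp add: in_variety_def)
  then have "range (\<lambda>x. interp I v (\<sigma> x)) \<subseteq> A"
    using ax by (auto intro!: interp_closed)
  with ax(1) assms show ?case
    by (auto simp: interp_subst in_variety_def)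
next
  case (cong ss f ts)
  have "map (interp I v) ss = map (interp I v) ts"
    using cong.IH cong.prems by (auto simp: list_all2_conv_all_nth intro: nth_equalityI)
  then show ?case by (simp only: interp.simps)
qed simp_all

text \<open>
  The bound on the variables of \<open>t\<close> is essential here: a variable beyond the length of \<open>us\<close> would
  be replaced by an unspecified term on the left and by an unrelated unspecified element on the right.
\<close>

lemma interp_inst:
  assumes "kary ar (length us) t"
  shows "interp I v (inst t us) = term_op I t (map (interp I v) us)"
  using assms unfolding inst_def term_op_def interp_subst kary_def
  by (intro interp_cong_vars) auto

lemma term_op_closed:
  assumes "algebra ar A I" "kary ar (length as) t" "set as \<subseteq> A"
  shows "term_op I t as \<in> A"
  using assms unfolding term_op_def kary_def
  by (intro interp_closed) (auto simp: subset_iff)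

context
  fixes ar :: "'f \<Rightarrow> nat" and E n e \<alpha> \<theta> and A :: "'a set" and I
  assumes protomodular: "protomodular_algebra ar E n e \<alpha> \<theta> A I"
begin

lemma algebra: "algebra ar A I"
  and variety: "in_variety ar E A I"
  using protomodular by (auto simp: protomodular_algebra_def in_variety_def)

lemma alpha_kary: "i \<in> {1..n} \<Longrightarrow> kary ar 2 (\<alpha> i)"
  and theta_kary: "kary ar (n + 1) \<theta>"
  using protomodular by (auto simp: protomodular_algebra_def protomodular_terms_def)

lemma alpha_closed:
  assumes "i \<in> {1..n}" "a \<in> A" "b \<in> A"
  shows "term_op I (\<alpha> i) [a, b] \<in> A"
  using assms alpha_kary by (intro term_op_closed[OF algebra]) (auto simp: numeral_2_eq_2)

lemma malcev_closed:
  assumes "a \<in> A" "b \<in> A" "c \<in> A"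
  shows "malcev n \<alpha> \<theta> I a b c \<in> A"
  unfolding malcev_def using assms theta_kary alpha_closed
  by (intro term_op_closed[OF algebra]) (auto simp del: upt_Suc)

lemma alpha_diagonal_constant:
  assumes i: "i \<in> {1..n}" and "a \<in> A" "b \<in> A"
  shows "term_op I (\<alpha> i) [a, a] = term_op I (\<alpha> i) [b, b]"
proof -
  have diag: "term_op I (\<alpha> i) [c, c] = interp I (\<lambda>_. c) (e i)" if "c \<in> A" for c
  proof -
    have "derivable ar E (inst (\<alpha> i) [Var 0, Var 0]) (e i)"
      using protomodular i by (auto simp: protomodular_algebra_def protomodular_terms_def)
    then have "interp I (\<lambda>_. c) (inst (\<alpha> i) [Var 0, Var 0]) = interp I (\<lambda>_. c) (e i)"
      using that by (intro derivable_sound[OF variety]) auto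
    then show ?thesis
      using alpha_kary[OF i] by (simp add: interp_inst numeral_2_eq_2)
  qed
  have "vars (e i) = {}"
    using protomodular i
    by (auto simp: protomodular_algebra_def protomodular_terms_def kary_def)
  then have "interp I (\<lambda>_. a) (e i) = interp I (\<lambda>_. b) (e i)"
    by (intro interp_cong_vars) simp
  with assms show ?thesis by (simp add: diag)
qed

lemma malcev_right_unit:
  assumes "a \<in> A" "b \<in> A"
  shows "malcev n \<alpha> \<theta> I a b b = a"
proof -
  define v where "v = (\<lambda>j::nat. if j = 0 then a else b)"
  let ?diffs = "map (\<lambda>i. inst (\<alpha> i) [Var 0, Var 1]) [1..<n + 1]"
  have "derivable ar E (inst \<theta> (?diffs @ [Var 1])) (Var 0)"
    using protomodular by (simp add: protomodular_algebra_def protomodular_terms_def)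
  moreover have "range v \<subseteq> A"
    using assms by (auto simp: v_def)
  ultimately have "interp I v (inst \<theta> (?diffs @ [Var 1])) = interp I v (Var 0)"
    by (rule derivable_sound[OF variety])
  moreover have "interp I v (inst \<theta> (?diffs @ [Var 1]))
      = term_op I \<theta> (map (interp I v) (?diffs @ [Var 1]))"
    using theta_kary by (intro interp_inst[where ar = ar]) (simp del: upt_Suc)
  moreover have "map (interp I v) ?diffs = map (\<lambda>i. term_op I (\<alpha> i) [a, b]) [1..<n + 1]"
    using alpha_kary by (auto simp: interp_inst[where ar = ar] numeral_2_eq_2 v_def simp del: upt_Suc)
  ultimately show ?thesis
    by (simp only: malcev_def map_append list.map interp.simps) (simp add: v_def)
qed

lemma malcev_eqI:
  assumes "\<And>i. i \<in> {1..n} \<Longrightarrow> term_op I (\<alpha> i) [a, b] = term_op I (\<alpha> i) [a', b']"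
  shows "malcev n \<alpha> \<theta> I a b c = malcev n \<alpha> \<theta> I a' b' c"
proof -
  have "map (\<lambda>i. term_op I (\<alpha> i) [a, b]) [1..<n + 1]
      = map (\<lambda>i. term_op I (\<alpha> i) [a', b']) [1..<n + 1]"
    using assms by (intro map_cong) auto
  then show ?thesis by (simp only: malcev_def)
qed

text \<open>
  All diagonal differences agree, so \<open>p(a, a, c) = p(c, c, c)\<close>, which is an instance of the other
  unit law.
\<close>

lemma malcev_left_unit:
  assumes "a \<in> A" "c \<in> A"
  shows "malcev n \<alpha> \<theta> I a a c = c"
  using malcev_eqI[OF alpha_diagonal_constant[OF _ assms]] malcev_right_unit[OF assms(2,2)]
  by simp

text \<open>
  With the entries \<open>\<alpha>(x, b)\<close> and \<open>\<alpha>(y, b)\<close>, right-cancellability says that the difference of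
  \<open>p(x, b, c)\<close> and \<open>p(y, b, c)\<close> does not depend on \<open>c\<close>; at \<open>c = b\<close> it is the difference of \<open>x\<close>
  and \<open>y\<close>.
\<close>

lemma alpha_translation_invariant:
  assumes "right_cancellable n \<alpha> \<theta> A I"
    and i: "i \<in> {1..n}" and A: "x \<in> A" "y \<in> A" "b \<in> A" "c \<in> A"
  shows "term_op I (\<alpha> i) [malcev n \<alpha> \<theta> I x b c, malcev n \<alpha> \<theta> I y b c] = term_op I (\<alpha> i) [x, y]"
proof -
  define d where "d = (\<lambda>a. map (\<lambda>i. term_op I (\<alpha> i) [a, b]) [1..<n + 1])"
  have d: "length (d a) = n \<and> set (d a) \<subseteq> A" if "a \<in> A" for a
    using alpha_closed that A by (auto simp: d_def)
  have p: "malcev n \<alpha> \<theta> I a b c' = term_op I \<theta> (d a @ [c'])" for a c'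
    by (simp only: malcev_def d_def)
  have "term_op I (\<alpha> i) [malcev n \<alpha> \<theta> I x b c, malcev n \<alpha> \<theta> I y b c]
      = term_op I (\<alpha> i) [malcev n \<alpha> \<theta> I x b b, malcev n \<alpha> \<theta> I y b b]"
    unfolding p using assms(1)[unfolded right_cancellable_def] i A d[of x] d[of y] by blast
  with A show ?thesis by (simp add: malcev_right_unit)
qed

end

theorem corollary5p4:
  fixes ar :: "'f \<Rightarrow> nat"
    and E :: "(('f, nat) trm \<times> ('f, nat) trm) set"
    and n :: nat
    and e \<alpha> :: "nat \<Rightarrow> ('f, nat) trm"
    and \<theta> :: "('f, nat) trm"
    and A :: "'a set"
    and I :: "'f \<Rightarrow> 'a list \<Rightarrow> 'a"
  assumes "n \<ge> 1"
    and "protomodular_algebra ar E n e \<alpha> \<theta> A I"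
    and "right_cancellable n \<alpha> \<theta> A I"
  shows "\<forall>x\<in>A. \<forall>t\<in>A. \<forall>s\<in>A. \<forall>y\<in>A. \<forall>z\<in>A.
    malcev n \<alpha> \<theta> I x t (malcev n \<alpha> \<theta> I s y z) = malcev n \<alpha> \<theta> I (malcev n \<alpha> \<theta> I x t s) y z"
proof (intro ballI)
  note pm = assms(2)
  note invariant = alpha_translation_invariant[OF pm assms(3)]
  let ?p = "malcev n \<alpha> \<theta> I"
  fix x t s y z
  assume A: "x \<in> A" "t \<in> A" "s \<in> A" "y \<in> A" "z \<in> A"
  define u where "u = ?p x t s"
  have u: "u \<in> A" and syz: "?p s y z \<in> A"
    using A by (auto simp: u_def intro: malcev_closed[OF pm])
  then have uyz: "?p u y z \<in> A"
    using A by (auto intro: malcev_closed[OF pm])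
  have "term_op I (\<alpha> i) [x, t] = term_op I (\<alpha> i) [?p u y z, ?p s y z]" if i: "i \<in> {1..n}" for i
  proof -
    have "term_op I (\<alpha> i) [x, t] = term_op I (\<alpha> i) [?p x t s, ?p t t s]"
      using invariant[OF i] A by simp
    also have "\<dots> = term_op I (\<alpha> i) [u, s]"
      using malcev_left_unit[OF pm] A by (simp add: u_def)
    also have "\<dots> = term_op I (\<alpha> i) [?p u y z, ?p s y z]"
      using invariant[OF i] A u by simp
    finally show ?thesis .
  qed
  then have "?p x t (?p s y z) = ?p (?p u y z) (?p s y z) (?p s y z)"
    by (rule malcev_eqI[OF pm])
  also have "\<dots> = ?p u y z"
    using malcev_right_unit[OF pm uyz syz] .
  finally show "?p x t (?p s y z) = ?p (?p x t s) y z"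
    by (simp only: u_def)
qed

end
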